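(* Let $M$ be a finite set of prime numbers. If $x$ is an $M$-prime, then $K\cdot\prod_{p_i\in M}p_i - x$ is an $M$-prime for every integer $K$.
   Context: For a set $M$ of prime numbers, an $M$-prime is an integer not divisible by any of the primes in $M$. *)

theory Defs
  imports "HOL-Computational_Algebra.Primes"
begin

definition M_prime :: "int set \<Rightarrow> int \<Rightarrow> bool" where
  "M_prime M x \<longleftrightarrow> (\<forall>p\<in>M. \<not> p dvd x)"

end

theory Submission
  imports Defs
begin

text \<open>Modulo each \<open>p\<close> in \<open>M\<close> the product vanishes, so
  \<open>K * (\<Prod>p\<in>M. p) - x\<close> is congruent to \<open>-x\<close>; hence
  \<open>p\<close> divides it exactly when \<open>p\<close> divides \<open>x\<close>, which
  \<open>M_prime M x\<close> excludes. \<open>dvd_prodI\<close> and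
  \<open>dvd_diff_right_iff\<close> carry this.\<close>

theorem mainTheorem8:
  fixes M :: "int set" and x :: int
  assumes "finite M" and "\<forall>p\<in>M. prime p"
    and "M_prime M x"
  shows "\<forall>K::int. M_prime M (K * (\<Prod>p\<in>M. p) - x)"
  unfolding M_prime_def
proof (intro allI ballI)
  fix K p :: int
  assume "p \<in> M"
  \<comment> \<open>Finiteness matters here: a product over an infinite set is 1 by convention,
    which no prime divides.\<close>
  with \<open>finite M\<close> have "p dvd (\<Prod>p\<in>M. p)"
    by (rule dvd_prodI)
  then have "p dvd K * (\<Prod>p\<in>M. p)"
    by (rule dvd_mult)
  then have "p dvd K * (\<Prod>p\<in>M. p) - x \<longleftrightarrow> p dvd x"
    by (rule dvd_diff_right_iff)
  with \<open>p \<in> M\<close> \<open>M_prime M x\<close> show "\<not> p dvd K * (\<Prod>p\<in>M. p) - x"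
    by (simp add: M_prime_def)
qed

end
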